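(* Let $\kappa$ be a regular uncountable ordinal. Then for every $t\in[\kappa,\kappa\omega)$, $A^0(t)$ is closed unbounded in $\kappa$.
   Context: All variables range over ordinals; each ordinal is identified with the set of smaller ordinals, so for a set $S$ of ordinals and an ordinal $\beta$, $S\subset\beta$ means that all elements of $S$ are $<\beta$. Sums and products are ordinal operations. $\mathrm{Class}(0):=\mathbb{P}=\{\omega^\gamma:\gamma>0\}$ is the class of additive principal ordinals. $\mathrm{Lim}$ is the class of limit ordinals (nonzero), and for a class $A$ of ordinals, $\mathrm{Lim}\,A:=\{\alpha\neq 0:\alpha=\sup(A\cap\alpha)\}$. For $\alpha\le\beta$, $-\alpha+\beta$ is the unique $\sigma$ with $\alpha+\sigma=\beta$. A class $C$ of ordinals is called closed unbounded in $\kappa$ if $C\cap\kappa$ is a closed unbounded subset of $\kappa$. The sets $T$. For $\alpha\in\mathrm{Class}(0)$ and $t<\alpha\omega$: $T(0,\alpha,t):=\{t\}$ if $t<\alpha$, and $T(0,\alpha,t):=\{t,-\alpha n+t\}$ if $t\in[\alpha n,\alpha n+\alpha)$ with $n\in[1,\omega)$. The classes $A^0(t)$. For $t\ge\omega$ let $\alpha\in\mathrm{Class}(0)$ be the unique one with $t\in[\alpha,\alpha\omega)$. By recursion on $t$: - if $t=\alpha$: $A^0(t):=(\mathrm{Lim}\,\mathrm{Class}(0))\cap(\alpha+1)$; - if $t=l+1$: $A^0(t):=\mathrm{Lim}\,A^0(l)$; - if $t\in(\alpha,\alpha\omega)\cap\mathrm{Lim}$: $A^0(t):=\mathrm{Lim}\{r\in\mathrm{Class}(0)\cap(\alpha+1):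 T(0,\alpha,t)\cap\alpha\subset r \text{ and } r\in A^0(s)\text{ for every } s\in(\alpha,t)\text{ with }T(0,\alpha,s)\cap\alpha\subset r\}$. *)

theory Defs
  imports Main "HOL-Library.Countable_Set"
begin

unbundle cardinal_syntax

text \<open>
  HOL has no type of all ordinals. \<open>'a ordinal\<close> is the initial segment of the ordinals
  consisting of all ordinals below the successor cardinal of \<open>\<aleph>\<^sub>0 + |'a|\<close>, i.e. of all
  order types of well-orders on subsets of \<open>nat + 'a\<close> (lemma \<open>ordinal_represents\<close>). It is
  closed under the ordinal operations, and as \<open>'a\<close> is arbitrary, every ordinal is covered.
\<close>

abbreviation ordinal_base :: "(nat + 'a) set rel" where
  "ordinal_base \<equiv> cardSuc |UNIV :: (nat + 'a) set|"

typedef 'a ordinal = "Field (ordinal_base :: (nat + 'a) set rel)"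
  using Field_cardSuc_not_empty[OF card_of_Card_order] by blast

setup_lifting type_definition_ordinal

lemma ordinal_base_Well_order: "Well_order (ordinal_base :: (nat + 'a) set rel)"
  by (rule cardSuc_Well_order[OF card_of_Card_order])

instantiation ordinal :: (type) linorder
begin

lift_definition less_eq_ordinal :: "'a ordinal \<Rightarrow> 'a ordinal \<Rightarrow> bool"
  is "\<lambda>x y. (x, y) \<in> ordinal_base" .

definition less_ordinal :: "'a ordinal \<Rightarrow> 'a ordinal \<Rightarrow> bool" where
  "less_ordinal x y \<longleftrightarrow> x \<le> y \<and> \<not> y \<le> x"

instance
proof
  note W = ordinal_base_Well_order[where 'a = 'a, unfolded well_order_on_def
      linear_order_on_def partial_order_on_def preorder_on_def]
  fix x y z :: "'a ordinal"
  show "x < y \<longleftrightarrow> x \<le> y \<and> \<not> y \<le> x" by (fact less_ordinal_def)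
  show "x \<le> x" using W by transfer (auto simp: refl_on_def)
  show "x \<le> y \<Longrightarrow> y \<le> z \<Longrightarrow> x \<le> z" using W by transfer (meson transE)
  show "x \<le> y \<Longrightarrow> y \<le> x \<Longrightarrow> x = y" using W by transfer (meson antisymD)
  show "x \<le> y \<or> y \<le> x"
    using W by transfer (metis refl_onD total_on_def)
qed

end

lemma Rep_ordinal_less:
  "x < y \<longleftrightarrow> Rep_ordinal x \<in> underS ordinal_base (Rep_ordinal y)"
  using Rep_ordinal_inject[of x y]
  by (auto simp: underS_def less_eq_ordinal.rep_eq order.strict_iff_order)

instance ordinal :: (type) wellorder
proof (rule wf_wellorderI)
  have "wf (ordinal_base - Id :: (nat + 'a) set rel)"
    using ordinal_base_Well_order[where 'a = 'a] by (simp add: well_order_on_def)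
  then have "wf (inv_image (ordinal_base - Id) (Rep_ordinal :: 'a ordinal \<Rightarrow> _))"
    by (rule wf_inv_image)
  moreover have "{(x, y::'a ordinal). x < y} = inv_image (ordinal_base - Id) Rep_ordinal"
    by (auto simp: Rep_ordinal_less underS_def)
  ultimately show "wf {(x, y::'a ordinal). x < y}" by simp
qed intro_classes

instantiation ordinal :: (type) conditionally_complete_linorder
begin

definition Sup_ordinal :: "'a ordinal set \<Rightarrow> 'a ordinal" where
  "Sup_ordinal S = (LEAST b. \<forall>x\<in>S. x \<le> b)"

definition Inf_ordinal :: "'a ordinal set \<Rightarrow> 'a ordinal" where
  "Inf_ordinal S = (LEAST x. x \<in> S)"

definition inf_ordinal :: "'a ordinal \<Rightarrow> 'a ordinal \<Rightarrow> 'a ordinal" where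
  "inf_ordinal = min"

definition sup_ordinal :: "'a ordinal \<Rightarrow> 'a ordinal \<Rightarrow> 'a ordinal" where
  "sup_ordinal = max"

instance
proof
  fix x y z :: "'a ordinal" and X :: "'a ordinal set"
  show "inf x y \<le> x" "inf x y \<le> y" "x \<le> sup x y" "y \<le> sup x y"
    by (auto simp: inf_ordinal_def sup_ordinal_def)
  show "x \<le> y \<Longrightarrow> x \<le> z \<Longrightarrow> x \<le> inf y z" by (auto simp: inf_ordinal_def)
  show "y \<le> x \<Longrightarrow> z \<le> x \<Longrightarrow> sup y z \<le> x" by (auto simp: sup_ordinal_def)
  show "x \<in> X \<Longrightarrow> bdd_below X \<Longrightarrow> Inf X \<le> x"
    by (simp add: Inf_ordinal_def Least_le)
  show "z \<le> Inf X" if "X \<noteq> {}" "\<And>x. x \<in> X \<Longrightarrow> z \<le> x"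
  proof -
    have "\<exists>x. x \<in> X" using that(1) by blast
    then show ?thesis unfolding Inf_ordinal_def by (rule that(2)[OF LeastI_ex])
  qed
  show "x \<le> Sup X" if "x \<in> X" "bdd_above X"
  proof -
    have "\<exists>b. \<forall>x\<in>X. x \<le> b" using that(2) by (auto simp: bdd_above_def)
    then have "\<forall>x\<in>X. x \<le> Sup X" unfolding Sup_ordinal_def by (rule LeastI_ex)
    then show ?thesis using that(1) by blast
  qed
  show "X \<noteq> {} \<Longrightarrow> (\<And>x. x \<in> X \<Longrightarrow> x \<le> z) \<Longrightarrow> Sup X \<le> z"
    unfolding Sup_ordinal_def by (rule Least_le) blast
qed

end

lemma dir_image_map_prod: "dir_image r f = map_prod f f ` r"
  unfolding dir_image_def by force

lemma ordinal_represents: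
  fixes r :: "(nat + 'a) rel"
  assumes "Well_order r"
  shows "\<exists>x :: 'a ordinal. r =o {(y, z). y \<le> z \<and> z < x}"
proof -
  let ?b = "ordinal_base :: (nat + 'a) set rel"
  have "r <o ?b"
  proof (rule ccontr)
    assume "\<not> r <o ?b"
    then have "?b \<le>o r"
      using assms ordinal_base_Well_order not_ordLeq_iff_ordLess by blast
    then have "|Field ?b| \<le>o |Field r|" by (rule card_of_mono2)
    also have "|Field r| \<le>o |UNIV :: (nat + 'a) set|" by (rule card_of_mono1) simp
    finally have "?b \<le>o |UNIV :: (nat + 'a) set|"
      using card_of_Field_ordIso[OF cardSuc_Card_order[OF card_of_Card_order]]
        ordIso_ordLeq_trans ordIso_symmetric by blast
    then show False
      using cardSuc_greater[OF card_of_Card_order[of "UNIV :: (nat + 'a) set"]]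
        not_ordLess_ordLeq by blast
  qed
  then obtain a where a: "a \<in> Field ?b" and ra: "r =o Restr ?b (underS ?b a)"
    using ordLess_iff_ordIso_Restr[OF ordinal_base_Well_order assms] by blast
  obtain x :: "'a ordinal" where x: "Rep_ordinal x = a"
    using a by (metis Abs_ordinal_inverse)
  let ?s = "{(y, z :: 'a ordinal). y \<le> z \<and> z < x}"
  let ?R = "Restr ?b (underS ?b a)"
  have wR: "Well_order ?R"
    by (rule Well_order_Restr[OF ordinal_base_Well_order])
  have eq: "?R = map_prod Rep_ordinal Rep_ordinal ` ?s" (is "_ = ?I")
  proof (intro equalityI subrelI)
    fix u v assume uv: "(u, v) \<in> ?R"
    then have "u \<in> Field ?b" "v \<in> Field ?b" by (auto simp: Field_def)
    then obtain y z :: "'a ordinal" where yz: "u = Rep_ordinal y" "v = Rep_ordinal z"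
      by (metis Abs_ordinal_inverse)
    then have "(y, z) \<in> ?s" using uv x by (auto simp: less_eq_ordinal.rep_eq Rep_ordinal_less)
    then show "(u, v) \<in> ?I" using yz by force
  next
    fix u v assume "(u, v) \<in> ?I"
    then obtain y z where yz: "u = Rep_ordinal y" "v = Rep_ordinal z" "y \<le> z" "z < x" by auto
    moreover from yz have "y < x" by auto
    ultimately show "(u, v) \<in> ?R" using x by (auto simp: less_eq_ordinal.rep_eq Rep_ordinal_less)
  qed
  have s_eq: "map_prod Abs_ordinal Abs_ordinal ` ?R = ?s"
  proof -
    have "map_prod Abs_ordinal Abs_ordinal ` map_prod Rep_ordinal Rep_ordinal ` ?s = id ` ?s"
      unfolding image_comp by (rule image_cong) (auto simp: Rep_ordinal_inverse)
    also have "id ` ?s = ?s" by simp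
    finally show ?thesis by (simp only: eq)
  qed
  have FR: "Field ?R \<subseteq> Field ?b" by (auto simp: Field_def)
  have "inj_on (Abs_ordinal :: _ \<Rightarrow> 'a ordinal) (Field ?R)"
    by (rule inj_on_subset[OF _ FR]) (rule inj_onI, simp add: Abs_ordinal_inject)
  then have "?R =o dir_image ?R (Abs_ordinal :: _ \<Rightarrow> 'a ordinal)"
    by (rule dir_image_ordIso[OF wR])
  moreover have "dir_image ?R (Abs_ordinal :: _ \<Rightarrow> 'a ordinal) = map_prod Abs_ordinal Abs_ordinal ` ?R"
    by (rule dir_image_map_prod)
  ultimately have "?R =o ?s" by (simp only: s_eq)
  then show ?thesis using ordIso_transitive[OF ra] by blast
qed

lemma bounded_ordinal:
  fixes S :: "'a ordinal set"
  assumes "|S| \<le>o |UNIV :: (nat + 'a) set|"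
  shows "\<exists>b. \<forall>x\<in>S. x < b"
proof (rule ccontr)
  let ?b = "ordinal_base :: (nat + 'a) set rel"
  assume "\<nexists>b. \<forall>x\<in>S. x < b"
  then have unb: "\<exists>x\<in>S. b \<le> x" for b by (meson not_less)
  have inf: "infinite (Field |UNIV :: (nat + 'a) set| )"
    by (simp add: Field_card_of)
  then have "infinite (Field ?b)"
    by (simp add: cardSuc_finite[OF card_of_Card_order])
  then have nomax: "\<exists>b. a < b" for a :: "'a ordinal"
    using infinite_Card_order_limit[OF cardSuc_Card_order[OF card_of_Card_order], of "UNIV :: (nat + 'a) set"
        "Rep_ordinal a"] Rep_ordinal[of a]
    by (metis Abs_ordinal_inverse Rep_ordinal_inject less_eq_ordinal.rep_eq order.not_eq_order_implies_strict)
  have "cofinal (Rep_ordinal ` S) ?b"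
    unfolding cofinal_def
  proof
    fix a assume "a \<in> Field ?b"
    then obtain x :: "'a ordinal" where x: "a = Rep_ordinal x" by (metis Abs_ordinal_inverse)
    obtain b where "x < b" using nomax by blast
    moreover obtain y where "y \<in> S" "b \<le> y" using unb by blast
    ultimately have "x < y" "y \<in> S" by auto
    then show "\<exists>b\<in>Rep_ordinal ` S. a \<noteq> b \<and> (a, b) \<in> ?b"
      using x by (auto simp: Rep_ordinal_less underS_def)
  qed
  moreover have "Rep_ordinal ` S \<subseteq> Field ?b" using Rep_ordinal by blast
  ultimately have "|Rep_ordinal ` S| =o ?b"
    using infinite_cardSuc_regularCard[OF inf card_of_Card_order]
    unfolding regularCard_def by blast
  moreover have "|Rep_ordinal ` S| \<le>o |UNIV :: (nat + 'a) set|"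
    using card_of_image assms ordLeq_transitive by blast
  ultimately show False
    using cardSuc_greater[OF card_of_Card_order[of "UNIV :: (nat + 'a) set"]]
    by (metis not_ordLess_ordLeq ordIso_ordLeq_trans ordIso_symmetric)
qed

lemma bdd_above_image_lessThan:
  fixes f :: "'a ordinal \<Rightarrow> 'a ordinal"
  shows "bdd_above (f ` {..<b})"
proof -
  have "|{..<b}| =o |Rep_ordinal ` {..<b}|"
    by (meson Rep_ordinal_inject card_of_ordIsoI inj_on_def inj_on_imp_bij_betw)
  also have "|Rep_ordinal ` {..<b}| \<le>o |underS (ordinal_base :: (nat + 'a) set rel) (Rep_ordinal b)|"
    by (rule card_of_mono1) (auto simp: Rep_ordinal_less)
  finally have "|{..<b}| <o (ordinal_base :: (nat + 'a) set rel)"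
    using card_of_underS[OF cardSuc_Card_order[OF card_of_Card_order] Rep_ordinal]
      ordLeq_ordLess_trans by blast
  then have "|{..<b}| \<le>o |UNIV :: (nat + 'a) set|"
    by (simp add: cardSuc_ordLeq_ordLess[OF card_of_Card_order card_of_Card_order])
  then have "|f ` {..<b}| \<le>o |UNIV :: (nat + 'a) set|"
    using card_of_image ordLeq_transitive by blast
  then obtain c where "\<forall>x \<in> f ` {..<b}. x < c" using bounded_ordinal by blast
  then show ?thesis by (auto simp: bdd_above_def intro: less_imp_le)
qed

lemma ordinal_ex_greater: "\<exists>c. (b :: 'a ordinal) < c"
proof -
  have "|{b}| \<le>o |UNIV :: (nat + 'a) set|"
    by (rule card_of_singl_ordLeq) simp
  then show ?thesis using bounded_ordinal[of "{b}"] by auto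
qed

lemma bdd_above_range_nat:
  fixes f :: "nat \<Rightarrow> 'a ordinal"
  shows "bdd_above (range f)"
proof -
  have "|UNIV :: nat set| \<le>o |UNIV :: (nat + 'a) set|"
    by (rule card_of_ordLeqI[of Inl]) auto
  then have "|range f| \<le>o |UNIV :: (nat + 'a) set|"
    using card_of_image ordLeq_transitive by blast
  then obtain c where "\<forall>x \<in> range f. x < c" using bounded_ordinal by blast
  then show ?thesis by (auto simp: bdd_above_def intro: less_imp_le)
qed

unbundle no cardinal_syntax

definition osuc :: "'a ordinal \<Rightarrow> 'a ordinal" where
  "osuc x = (LEAST y. x < y)"

lemma less_osuc [simp]: "x < osuc x"
  unfolding osuc_def using ordinal_ex_greater by (rule LeastI_ex)

lemma less_osuc_iff: "x < osuc y \<longleftrightarrow> x \<le> y"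
  by (metis less_osuc not_less not_less_Least order_le_less_trans osuc_def)

instantiation ordinal :: (type) "{zero, one}"
begin
definition zero_ordinal :: "'a ordinal" where "zero_ordinal = (LEAST x. True)"
definition one_ordinal :: "'a ordinal" where "one_ordinal = osuc 0"
instance ..
end

lemma ordinal_zero_le [simp]: "(0 :: 'a ordinal) \<le> x"
  by (simp add: zero_ordinal_def Least_le)

lemma ordinal_not_less_zero [simp]: "\<not> x < (0 :: 'a ordinal)"
  by (simp add: not_less)

text \<open>
  Addition, multiplication and \<open>\<omega>\<^sup>x\<close> are defined by transfinite recursion, with the zero,
  successor and limit clauses of the usual recursions merged into one supremum; the usual
  clauses are derived below.
\<close>

context
  notes image_cong [fundef_cong]
begin

function add_ordinal :: "'a ordinal \<Rightarrow> 'a ordinal \<Rightarrow> 'a ordinal" where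
  "add_ordinal x y = Sup (insert x ((\<lambda>z. osuc (add_ordinal x z)) ` {..<y}))"
  by auto
termination
  by (relation "inv_image {(x, y). x < y} snd") (auto intro: wf wf_inv_image)

end

declare add_ordinal.simps [simp del]

instantiation ordinal :: (type) plus
begin
definition plus_ordinal :: "'a ordinal \<Rightarrow> 'a ordinal \<Rightarrow> 'a ordinal" where
  "plus_ordinal = add_ordinal"
instance ..
end

lemma osuc_le_iff: "osuc x \<le> y \<longleftrightarrow> x < y"
  by (metis less_osuc_iff not_less)

lemma osuc_inject: "osuc x = osuc y \<longleftrightarrow> x = y"
  by (metis less_osuc less_osuc_iff order.antisym)

lemma plus_unfold:
  "x + y = Sup (insert x ((\<lambda>z. osuc (x + z)) ` {..<y}))" for x y :: "'a ordinal"
  unfolding plus_ordinal_def by (rule add_ordinal.simps)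

lemma plus_le_iff:
  "x + y \<le> b \<longleftrightarrow> x \<le> b \<and> (\<forall>z<y. x + z < b)" for x y b :: "'a ordinal"
  unfolding plus_unfold[of x y]
  by (subst cSup_le_iff) (auto simp: bdd_above_image_lessThan osuc_le_iff)

lemma plus_strict_mono: "z < y \<Longrightarrow> x + z < x + y" for x y z :: "'a ordinal"
  using plus_le_iff[of x y "x + y"] by simp

lemma plus_mono: "z \<le> y \<Longrightarrow> x + z \<le> x + y" for x y z :: "'a ordinal"
  using plus_strict_mono[of z y x] by (auto simp: order.order_iff_strict)

lemma plus_zero: "x + 0 = x" for x :: "'a ordinal"
proof (rule order.antisym)
  show "x + 0 \<le> x" by (simp add: plus_le_iff)
  show "x \<le> x + 0" using plus_le_iff[of x 0 "x + 0"] by simp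
qed

lemma plus_osuc: "x + osuc y = osuc (x + y)" for x y :: "'a ordinal"
proof (rule order.antisym)
  show "x + osuc y \<le> osuc (x + y)"
    using plus_le_iff[of x y "x + y"]
    by (auto simp: plus_le_iff less_osuc_iff intro: less_imp_le order_le_less_trans)
  show "osuc (x + y) \<le> x + osuc y"
    by (simp add: osuc_le_iff plus_strict_mono)
qed

lemma plus_one: "x + 1 = osuc x" for x :: "'a ordinal"
  by (simp add: one_ordinal_def plus_osuc plus_zero)

lemma plus_suc: "x + (y + 1) = (x + y) + 1" for x y :: "'a ordinal"
  by (simp add: plus_one plus_osuc)

definition limit_points :: "'a ordinal set \<Rightarrow> 'a ordinal set" where
  "limit_points A = {x. x \<noteq> 0 \<and> x = Sup (A \<inter> {..<x})}"

definition Limits :: "'a ordinal set" where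
  "Limits = {x. x \<noteq> 0 \<and> (\<forall>y. x \<noteq> y + 1)}"

lemma Limits_iff: "x \<in> Limits \<longleftrightarrow> x \<noteq> 0 \<and> (\<forall>y<x. y + 1 < x)" for x :: "'a ordinal"
  unfolding Limits_def mem_Collect_eq plus_one
  by (metis less_osuc nless_le osuc_le_iff)

lemma plus_limit:
  fixes x y :: "'a ordinal"
  assumes "y \<in> Limits"
  shows "x + y = Sup ((\<lambda>z. x + z) ` {..<y})"
proof (rule order.antisym)
  have ub: "x + z \<le> Sup ((\<lambda>z. x + z) ` {..<y})" if "z < y" for z
    using that by (intro cSup_upper bdd_above_image_lessThan) auto
  have "0 < y" using assms by (auto simp: Limits_iff order.strict_iff_order)
  then have "x \<le> Sup ((\<lambda>z. x + z) ` {..<y})" using ub[of 0] by (simp add: plus_zero)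
  moreover have "x + z < Sup ((\<lambda>z. x + z) ` {..<y})" if "z < y" for z
  proof -
    have "z + 1 < y" using assms that by (simp add: Limits_iff)
    then show ?thesis using ub[of "z + 1"] by (simp add: plus_suc) (simp add: plus_one osuc_le_iff)
  qed
  ultimately show "x + y \<le> Sup ((\<lambda>z. x + z) ` {..<y})" by (simp add: plus_le_iff)
  show "Sup ((\<lambda>z. x + z) ` {..<y}) \<le> x + y"
    using \<open>0 < y\<close> by (intro cSup_least) (auto intro: less_imp_le plus_strict_mono)
qed

lemma plus_left_mono: "x \<le> x' \<Longrightarrow> x + y \<le> x' + y" for x x' y :: "'a ordinal"
proof (induction y rule: less_induct)
  case (less y)
  have "x + z < x' + y" if "z < y" for z
    using less.IH[OF that less.prems] plus_strict_mono[OF that, of x'] by simp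
  moreover have "x \<le> x' + y" using less.prems plus_le_iff[of x' y "x' + y"] by auto
  ultimately show ?case by (simp add: plus_le_iff)
qed

context
  notes image_cong [fundef_cong]
begin

function mult_ordinal :: "'a ordinal \<Rightarrow> 'a ordinal \<Rightarrow> 'a ordinal" where
  "mult_ordinal x y = Sup ((\<lambda>z. mult_ordinal x z + x) ` {..<y})"
  by auto
termination
  by (relation "inv_image {(x, y). x < y} snd") (auto intro: wf wf_inv_image)

end

declare mult_ordinal.simps [simp del]

instantiation ordinal :: (type) times
begin
definition times_ordinal :: "'a ordinal \<Rightarrow> 'a ordinal \<Rightarrow> 'a ordinal" where
  "times_ordinal = mult_ordinal"
instance ..
end

lemma times_unfold:
  "x * y = Sup ((\<lambda>z. x * z + x) ` {..<y})" for x y :: "'a ordinal"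
  unfolding times_ordinal_def by (rule mult_ordinal.simps)

lemma times_zero: "x * 0 = 0" for x :: "'a ordinal"
proof -
  have "{..<0 :: 'a ordinal} = {}" by auto
  then have "x * 0 = Sup {}" unfolding times_unfold[of x 0] by simp
  then show ?thesis by (simp add: Sup_ordinal_def zero_ordinal_def)
qed

lemma times_le_iff: "x * y \<le> b \<longleftrightarrow> (\<forall>z<y. x * z + x \<le> b)" for x y b :: "'a ordinal"
proof (cases "y = 0")
  case True
  then show ?thesis by (simp add: times_zero)
next
  case False
  then have "0 < y" by (simp add: order.strict_iff_order)
  then show ?thesis unfolding times_unfold[of x y]
    by (subst cSup_le_iff) (auto simp: bdd_above_image_lessThan)
qed

lemma times_mono: "z \<le> y \<Longrightarrow> x * z \<le> x * y" for x y z :: "'a ordinal"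
  using times_le_iff[of x y "x * y"] by (auto simp: times_le_iff)

lemma times_suc: "x * (y + 1) = x * y + x" for x y :: "'a ordinal"
proof (rule order.antisym)
  show "x * (y + 1) \<le> x * y + x"
    by (auto simp: times_le_iff plus_one less_osuc_iff intro: plus_left_mono times_mono)
  show "x * y + x \<le> x * (y + 1)"
    using times_le_iff[of x "y + 1" "x * (y + 1)"] by (simp add: plus_one)
qed

lemma times_limit:
  fixes x y :: "'a ordinal"
  assumes "y \<in> Limits"
  shows "x * y = Sup ((\<lambda>z. x * z) ` {..<y})"
proof (rule order.antisym)
  have ub: "x * z \<le> Sup ((\<lambda>z. x * z) ` {..<y})" if "z < y" for z
    using that by (intro cSup_upper bdd_above_image_lessThan) auto
  have "0 < y" using assms by (auto simp: Limits_iff order.strict_iff_order)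
  show "x * y \<le> Sup ((\<lambda>z. x * z) ` {..<y})"
    unfolding times_le_iff
  proof (intro allI impI)
    fix z assume "z < y"
    then have "z + 1 < y" using assms by (simp add: Limits_iff)
    then show "x * z + x \<le> Sup ((\<lambda>z. x * z) ` {..<y})"
      using ub[of "z + 1"] by (simp add: times_suc)
  qed
  show "Sup ((\<lambda>z. x * z) ` {..<y}) \<le> x * y"
    using \<open>0 < y\<close> by (intro cSup_least) (auto intro: less_imp_le times_mono)
qed

lemma zero_plus: "0 + x = x" for x :: "'a ordinal"
proof (induction x rule: less_induct)
  case (less x)
  have "0 + x \<le> x" using less by (simp add: plus_le_iff)
  moreover have "\<not> 0 + x < x"
  proof
    assume "0 + x < x"
    then show False using less[of "0 + x"] plus_strict_mono[of "0 + x" x 0] by simp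
  qed
  ultimately show ?case by simp
qed

lemma times_one: "x * 1 = x" for x :: "'a ordinal"
  using times_suc[of x 0] by (simp add: zero_plus times_zero)

lemma one_times: "1 * x = x" for x :: "'a ordinal"
proof (induction x rule: less_induct)
  case (less x)
  have "1 * x \<le> x"
    using less by (auto simp: times_le_iff plus_one osuc_le_iff)
  moreover have "x \<le> 1 * x"
  proof (rule ccontr)
    assume "\<not> x \<le> 1 * x"
    then have "1 * x < x" by simp
    then have "1 * (1 * x) + 1 \<le> 1 * x" using times_le_iff[of 1 x "1 * x"] by simp
    then show False using less.IH[OF \<open>1 * x < x\<close>] by (simp add: plus_one osuc_le_iff)
  qed
  ultimately show ?case by simp
qed

lemma times_left_mono: "x \<le> x' \<Longrightarrow> x * y \<le> x' * y" for x x' y :: "'a ordinal"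
proof (induction y rule: less_induct)
  case (less y)
  have "x * z + x \<le> x' * y" if "z < y" for z
  proof -
    have "x * z + x \<le> x' * z + x'"
      using plus_left_mono[OF less.IH[OF that less.prems]] plus_mono[OF less.prems]
      by (rule order.trans)
    also have "\<dots> \<le> x' * y" using that times_le_iff[of x' y "x' * y"] by simp
    finally show ?thesis .
  qed
  then show ?case by (simp add: times_le_iff)
qed

definition omega :: "'a ordinal" (\<open>\<omega>\<close>) where
  "\<omega> = (LEAST x. x \<in> Limits)"

lemma omega_in_Limits: "(\<omega> :: 'a ordinal) \<in> Limits"
proof -
  define f :: "nat \<Rightarrow> 'a ordinal" where "f n = (osuc ^^ n) 0" for n
  have f_Suc: "f (Suc n) = osuc (f n)" for n by (simp add: f_def)
  have bdd: "bdd_above (range f)" by (rule bdd_above_range_nat)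
  have less: "f n < Sup (range f)" for n
  proof -
    have "f (Suc n) \<le> Sup (range f)" by (intro cSup_upper bdd) simp
    then show ?thesis by (simp add: f_Suc osuc_le_iff)
  qed
  have "y + 1 < Sup (range f)" if "y < Sup (range f)" for y
  proof -
    have "\<exists>n. y < f n" using that less_cSup_iff[OF _ bdd] by auto
    then obtain n where "y < f n" ..
    then have "y + 1 \<le> f n" by (simp add: plus_one osuc_le_iff)
    then show ?thesis using less[of n] by simp
  qed
  moreover have "Sup (range f) \<noteq> 0" using less[of 0] ordinal_zero_le leD by metis
  ultimately have "Sup (range f) \<in> Limits" by (simp add: Limits_iff)
  then show ?thesis unfolding omega_def by (rule LeastI)
qed

lemma one_le_omega: "(1 :: 'a ordinal) \<le> \<omega>"
  using omega_in_Limits[where 'a = 'a]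
  by (auto simp: Limits_iff one_ordinal_def osuc_le_iff order.strict_iff_order)

context
  notes image_cong [fundef_cong]
begin

function omega_power :: "'a ordinal \<Rightarrow> 'a ordinal" where
  "omega_power x = Sup (insert 1 ((\<lambda>z. omega_power z * \<omega>) ` {..<x}))"
  by auto
termination
  by (relation "{(x, y). x < y}") (auto intro: wf)

end

declare omega_power.simps [simp del]

lemma omega_power_le_iff:
  "omega_power x \<le> b \<longleftrightarrow> 1 \<le> b \<and> (\<forall>z<x. omega_power z * \<omega> \<le> b)"
  unfolding omega_power.simps[of x]
  by (subst cSup_le_iff) (auto simp: bdd_above_image_lessThan)

lemma omega_power_zero: "omega_power 0 = 1"
  by (rule order.antisym)
    (use omega_power_le_iff[of 0] omega_power_le_iff[of 0 "omega_power 0"] in auto)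

lemma omega_power_mono: "x \<le> y \<Longrightarrow> omega_power x \<le> omega_power y"
  using omega_power_le_iff[of y "omega_power y"] by (auto simp: omega_power_le_iff)

lemma omega_power_ge_one: "1 \<le> omega_power x"
  using omega_power_le_iff[of x "omega_power x"] by simp

lemma omega_power_le_times: "omega_power x \<le> omega_power x * \<omega>"
  using times_mono[OF one_le_omega, of "omega_power x"] by (simp add: times_one)

lemma omega_power_less: "z < x \<Longrightarrow> omega_power z * \<omega> \<le> omega_power x"
  using omega_power_le_iff[of x "omega_power x"] by simp

lemma omega_power_suc: "omega_power (x + 1) = omega_power x * \<omega>"
proof (rule order.antisym)
  show "omega_power x * \<omega> \<le> omega_power (x + 1)"
    by (rule omega_power_less) (simp add: plus_one)
  have "1 \<le> omega_power x * \<omega>"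
    using omega_power_ge_one omega_power_le_times by (rule order.trans)
  then show "omega_power (x + 1) \<le> omega_power x * \<omega>"
    by (auto simp: omega_power_le_iff plus_one less_osuc_iff
        intro: times_left_mono omega_power_mono)
qed

lemma omega_power_limit:
  assumes "x \<in> Limits"
  shows "omega_power x = Sup (omega_power ` {..<x})"
proof (rule order.antisym)
  have ub: "omega_power z \<le> Sup (omega_power ` {..<x})" if "z < x" for z
    using that by (intro cSup_upper bdd_above_image_lessThan) auto
  have "0 < x" using assms by (auto simp: Limits_iff order.strict_iff_order)
  show "omega_power x \<le> Sup (omega_power ` {..<x})"
    unfolding omega_power_le_iff
  proof (intro conjI allI impI)
    show "1 \<le> Sup (omega_power ` {..<x})"
      using ub[OF \<open>0 < x\<close>] by (simp add: omega_power_zero)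
    fix z assume "z < x"
    then have "z + 1 < x" using assms by (simp add: Limits_iff)
    then show "omega_power z * \<omega> \<le> Sup (omega_power ` {..<x})"
      using ub[of "z + 1"] by (simp add: omega_power_suc)
  qed
  show "Sup (omega_power ` {..<x}) \<le> omega_power x"
    using \<open>0 < x\<close> by (intro cSup_least) (auto intro: less_imp_le omega_power_mono)
qed

definition left_diff :: "'a ordinal \<Rightarrow> 'a ordinal \<Rightarrow> 'a ordinal" where
  "left_diff x y = (THE z. x + z = y)"

lemma left_diff_plus: "left_diff x (x + z) = z"
  unfolding left_diff_def
  by (rule the_equality) (auto, metis linorder_less_linear order_less_irrefl plus_strict_mono)

definition Class0 :: "'a ordinal set" where
  "Class0 = {omega_power x | x. 0 < x}"

definition T0 :: "'a ordinal \<Rightarrow> 'a ordinal \<Rightarrow> 'a ordinal set" where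
  "T0 a t = (if t < a then {t}
     else {t} \<union> {left_diff (a * n) t | n. n \<in> {1..<\<omega>} \<and> t \<in> {a * n..<a * n + a}})"

definition lead :: "'a ordinal \<Rightarrow> 'a ordinal" where
  "lead t = (THE a. a \<in> Class0 \<and> t \<in> {a..<a * \<omega>})"

lemma lead_eq:
  assumes "a \<in> Class0" "t \<in> {a..<a * \<omega>}"
  shows "lead t = a"
  unfolding lead_def
proof (rule the_equality)
  show "a \<in> Class0 \<and> t \<in> {a..<a * \<omega>}" using assms by simp
  fix b assume b: "b \<in> Class0 \<and> t \<in> {b..<b * \<omega>}"
  then obtain x y where xy: "a = omega_power x" "b = omega_power y"
    using assms by (auto simp: Class0_def)
  have "\<not> x < y" "\<not> y < x"
    using xy assms b omega_power_less[of x y] omega_power_less[of y x] by auto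
  then show "b = a" using xy by simp
qed

text \<open>For \<open>t < \<omega>\<close>, where the class is not defined, the value is the junk value \<open>{}\<close>.\<close>

function A0 :: "'a ordinal \<Rightarrow> 'a ordinal set" where
  "A0 t =
    (if t < \<omega> then {}
     else if t = lead t then limit_points Class0 \<inter> {..<lead t + 1}
     else if t \<in> Limits then
       limit_points {r \<in> Class0 \<inter> {..<lead t + 1}.
         T0 (lead t) t \<inter> {..<lead t} \<subseteq> {..<r} \<and>
         (\<forall>s\<in>{lead t<..<t}. T0 (lead t) s \<inter> {..<lead t} \<subseteq> {..<r} \<longrightarrow> r \<in> A0 s)}
     else limit_points (A0 (THE l. t = l + 1)))"
  by auto
termination
proof (relation "{(x, y). x < y}")
  fix t :: "'a ordinal"
  assume "\<not> t < \<omega>" "t \<notin> Limits"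
  then have "t \<noteq> 0"
    using one_le_omega[where 'a = 'a] by (metis less_osuc not_less one_ordinal_def order_less_le_trans)
  then obtain l where l: "t = l + 1" using \<open>t \<notin> Limits\<close> by (auto simp: Limits_def)
  then have "(THE l. t = l + 1) = l"
    by (intro the_equality) (auto simp: plus_one osuc_inject)
  then show "(THE l. t = l + 1, t) \<in> {(x, y). x < y}" using l by (simp add: plus_one)
qed (auto intro: wf)

declare A0.simps [simp del]

lemma omega_le_Class0:
  assumes "a \<in> Class0"
  shows "\<omega> \<le> a"
proof -
  obtain x where x: "a = omega_power x" "0 < x" using assms by (auto simp: Class0_def)
  show ?thesis using omega_power_less[OF x(2)] x(1) by (simp add: omega_power_zero one_times)
qed

lemma A0_principal:
  assumes "a \<in> Class0"
  shows "A0 a = limit_points Class0 \<inter> {..<a + 1}"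
proof -
  have "0 < a"
    using omega_le_Class0[OF assms] one_le_omega[where 'a = 'a]
    by (simp add: one_ordinal_def osuc_le_iff)
  have "1 < (\<omega> :: 'a ordinal)"
    using omega_in_Limits[where 'a = 'a] one_le_omega[where 'a = 'a]
    by (metis Limits_iff one_ordinal_def osuc_le_iff plus_one)
  have "a < a + a" using plus_strict_mono[OF \<open>0 < a\<close>, of a] by (simp add: plus_zero)
  also have "\<dots> \<le> a * \<omega>"
    using times_le_iff[of a \<omega> "a * \<omega>"] \<open>1 < \<omega>\<close> by (auto simp: times_one)
  finally have "lead a = a" using assms by (intro lead_eq) auto
  then show ?thesis using assms omega_le_Class0[of a] A0.simps[of a] by (auto simp: not_less)
qed

lemma A0_suc:
  assumes "a \<in> Class0" "l + 1 \<in> {a<..<a * \<omega>}"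
  shows "A0 (l + 1) = limit_points (A0 l)"
proof -
  have "lead (l + 1) = a" by (rule lead_eq) (use assms in auto)
  moreover have "\<not> l + 1 < \<omega>" using omega_le_Class0[OF assms(1)] assms(2) by auto
  moreover have "l + 1 \<notin> Limits" by (auto simp: Limits_def)
  moreover have "(THE k. l + 1 = k + 1) = l"
    by (intro the_equality) (auto simp: plus_one osuc_inject)
  ultimately show ?thesis using assms A0.simps[of "l + 1"] by auto
qed

lemma A0_limit:
  assumes "a \<in> Class0" "t \<in> {a<..<a * \<omega>}" "t \<in> Limits"
  shows "A0 t = limit_points {r \<in> Class0 \<inter> {..<a + 1}.
    T0 a t \<inter> {..<a} \<subseteq> {..<r} \<and>
    (\<forall>s\<in>{a<..<t}. T0 a s \<inter> {..<a} \<subseteq> {..<r} \<longrightarrow> r \<in> A0 s)}"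
proof -
  have "lead t = a" by (rule lead_eq) (use assms in auto)
  moreover have "\<not> t < \<omega>" using omega_le_Class0[OF assms(1)] assms(2) by auto
  ultimately show ?thesis using assms A0.simps[of t] by auto
qed

definition closed_unbounded_in :: "'a ordinal set \<Rightarrow> 'a ordinal \<Rightarrow> bool" where
  "closed_unbounded_in C k \<longleftrightarrow>
     (\<forall>x<k. \<exists>y\<in>C \<inter> {..<k}. x < y) \<and> limit_points (C \<inter> {..<k}) \<inter> {..<k} \<subseteq> C"

definition cofinality :: "'a ordinal \<Rightarrow> 'a ordinal" where
  "cofinality k = (LEAST b. \<exists>f. f ` {..<b} \<subseteq> {..<k} \<and> (\<forall>x<k. \<exists>y<b. x \<le> f y))"

definition regular :: "'a ordinal \<Rightarrow> bool" where
  "regular k \<longleftrightarrow> k \<in> Limits \<and> cofinality k = k"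

end

theory Submission
  imports Defs
begin

text \<open>
  Every \<open>A0 t\<close> is a class of limit points and hence closed, so only unboundedness in \<open>\<kappa>\<close> is
  at stake. It is proved by induction on \<open>t\<close>. As \<open>\<kappa>\<close> is regular and \<open>\<omega> < \<kappa>\<close>, it suffices to
  close off \<open>\<omega>\<close> many times. At a limit \<open>t\<close>, every \<open>s \<in> (\<kappa>, t)\<close> is \<open>\<kappa> * m + c\<close> with \<open>m < \<omega>\<close> and
  \<open>c \<in> T(0, \<kappa>, s) \<inter> \<kappa>\<close>, so fewer than \<open>\<kappa>\<close> many \<open>s\<close> have \<open>T(0, \<kappa>, s) \<inter> \<kappa> \<subset> x\<close> for a given
  \<open>x < \<kappa>\<close>, and one can go above an element of each of the unbounded sets \<open>A0 s\<close> at once.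
\<close>

section \<open>Ordinal arithmetic\<close>

lemma ordinal_neq_zero_iff: "x \<noteq> 0 \<longleftrightarrow> 0 < x" for x :: "'a ordinal"
  by (auto simp: order.strict_iff_order)

lemma osuc_less_Limits: "x \<in> Limits \<Longrightarrow> y < x \<Longrightarrow> osuc y < x"
  by (simp add: Limits_iff plus_one)

text \<open>Replaces the supremum by approximation from below, the form used throughout. The
  supremum of the empty set is 0, so a nonzero limit point has members of \<open>B\<close> below
  it.\<close>

lemma limit_points_iff:
  "r \<in> limit_points B \<longleftrightarrow> r \<noteq> 0 \<and> (\<forall>z<r. \<exists>b\<in>B. z < b \<and> b < r)"
proof
  assume r: "r \<in> limit_points B"
  then have r0: "r \<noteq> 0" and sup: "r = Sup (B \<inter> {..<r})" by (auto simp: limit_points_def)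
  have "B \<inter> {..<r} \<noteq> {}"
  proof
    assume e: "B \<inter> {..<r} = {}"
    show False using sup r0 unfolding e by (simp add: Sup_ordinal_def zero_ordinal_def)
  qed
  moreover have "bdd_above (B \<inter> {..<r})" by (rule bdd_aboveI[of _ r]) auto
  ultimately have "\<exists>b\<in>B \<inter> {..<r}. z < b" if "z < r" for z
    using that less_cSup_iff[of "B \<inter> {..<r}" z] sup by simp
  then show "r \<noteq> 0 \<and> (\<forall>z<r. \<exists>b\<in>B. z < b \<and> b < r)" using r0 by blast
next
  assume r: "r \<noteq> 0 \<and> (\<forall>z<r. \<exists>b\<in>B. z < b \<and> b < r)"
  then have "B \<inter> {..<r} \<noteq> {}" by (auto simp: ordinal_neq_zero_iff)
  moreover have bdd: "bdd_above (B \<inter> {..<r})" by (rule bdd_aboveI[of _ r]) auto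
  ultimately have "Sup (B \<inter> {..<r}) \<le> r" by (intro cSup_least) auto
  moreover have "\<not> Sup (B \<inter> {..<r}) < r"
  proof
    assume "Sup (B \<inter> {..<r}) < r"
    then obtain b where "b \<in> B" "Sup (B \<inter> {..<r}) < b" "b < r" using r by blast
    then show False using cSup_upper[OF _ bdd, of b] by (simp add: not_le)
  qed
  ultimately show "r \<in> limit_points B" using r by (simp add: limit_points_def order.strict_iff_order)
qed

text \<open>Source of closedness: between \<open>z\<close> and \<open>r\<close> lies a limit point
  of \<open>B\<close>, and just below that one, still above \<open>z\<close>, a member of
  \<open>B\<close>.\<close>

lemma limit_points_limit_points: "limit_points (limit_points B) \<subseteq> limit_points B"
proof
  fix r assume "r \<in> limit_points (limit_points B)"
  then have r: "r \<noteq> 0" "\<forall>z<r. \<exists>b\<in>limit_points B. z < b \<and> b < r"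
    by (simp_all add: limit_points_iff)
  have "\<exists>b\<in>B. z < b \<and> b < r" if "z < r" for z
  proof -
    obtain c where "c \<in> limit_points B" "z < c" "c < r" using r \<open>z < r\<close> by blast
    then show ?thesis unfolding limit_points_iff by (meson order.strict_trans)
  qed
  then show "r \<in> limit_points B" using r by (simp add: limit_points_iff)
qed

lemma limit_points_mono: "A \<subseteq> B \<Longrightarrow> limit_points A \<subseteq> limit_points B"
  unfolding limit_points_iff subset_iff by blast

text \<open>Surjective because \<omega> is the least limit: everything below it is 0 or a successor.
  Gives countability of \<omega> and lets sequences over \<open>nat\<close> be reindexed by
  ordinals.\<close>

lemma bij_betw_omega: "bij_betw (\<lambda>n. (osuc ^^ n) 0) UNIV {..<\<omega> :: 'a ordinal}"
proof -
  let ?f = "\<lambda>n. (osuc ^^ n) 0 :: 'a ordinal"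
  have "strict_mono ?f" by (simp add: strict_mono_Suc_iff)
  then have "inj ?f" by (rule strict_mono_imp_inj_on)
  moreover have "?f n < \<omega>" for n
  proof (induction n)
    case 0
    then show ?case using omega_in_Limits[where 'a = 'a] by (simp add: Limits_iff ordinal_neq_zero_iff)
  next
    case (Suc n)
    then show ?case using osuc_less_Limits[OF omega_in_Limits] by simp
  qed
  moreover have "x < \<omega> \<Longrightarrow> x \<in> range ?f" for x
  proof (induction x rule: less_induct)
    case (less x)
    show ?case
    proof (cases "x = 0")
      case True
      then have "x = ?f 0" by simp
      then show ?thesis by blast
    next
      case False
      moreover have "x \<notin> Limits" using less.prems unfolding omega_def by (rule not_less_Least)
      ultimately obtain y where y: "x = osuc y" by (auto simp: Limits_def plus_one)
      moreover have "y < x" using y by simp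
      ultimately have "y \<in> range ?f" using less by (meson order.strict_trans)
      then obtain n where "y = ?f n" by blast
      then have "x = ?f (Suc n)" using y by simp
      then show ?thesis by blast
    qed
  qed
  ultimately show ?thesis unfolding bij_betw_def by auto
qed

lemma countable_lessThan_omega: "countable {..<\<omega>}"
  by (rule countableI_bij1[OF bij_betw_omega]) simp

section \<open>Subtraction and division with remainder\<close>

lemma ordinal_le_plus: "y \<le> x + y" for x y :: "'a ordinal"
  using plus_left_mono[of 0 x y] by (simp add: zero_plus)

lemma ordinal_diff_exists:
  fixes x y :: "'a ordinal"
  assumes "x \<le> y"
  shows "\<exists>z. y = x + z"
proof -
  let ?z = "LEAST z. y \<le> x + z"
  have "y \<le> x + ?z" by (rule LeastI[of _ y]) (rule ordinal_le_plus)
  \<comment> \<open>By minimality all earlier sums stay below \<open>y\<close>, which is what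
    \<open>plus_le_iff\<close> asks for.\<close>
  moreover have "x + ?z \<le> y"
    using assms by (auto simp: plus_le_iff not_le dest: not_less_Least)
  ultimately show ?thesis by (metis order.antisym)
qed

text \<open>The least multiplier taking \<open>a\<close> beyond \<open>s\<close> is not 0 and, by
  continuity of multiplication, not a limit. Its predecessor is the quotient.\<close>

lemma ordinal_division:
  fixes a s :: "'a ordinal"
  assumes "s < a * \<omega>"
  shows "\<exists>m c. m < \<omega> \<and> c < a \<and> s = a * m + c"
proof -
  let ?y = "LEAST y. s < a * y"
  have y: "s < a * ?y" using assms by (rule LeastI)
  have least: "a * z \<le> s" if "z < ?y" for z
    using not_less_Least[OF that] by simp
  have "?y \<noteq> 0" using y times_zero[of a] by auto
  moreover have "?y \<notin> Limits"
  proof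
    assume lim: "?y \<in> Limits"
    have "a * ?y \<le> s" unfolding times_limit[OF lim]
      by (rule cSup_least) (use \<open>?y \<noteq> 0\<close> least in \<open>auto simp: ordinal_neq_zero_iff\<close>)
    then show False using y by simp
  qed
  ultimately obtain m where m: "?y = m + 1" by (auto simp: Limits_def)
  have my: "m < ?y" unfolding m by (simp add: plus_one)
  then have "m < \<omega>" using Least_le[of "\<lambda>y. s < a * y", OF assms] by simp
  moreover obtain c where c: "s = a * m + c" using ordinal_diff_exists[OF least[OF my]] ..
  moreover have "s < a * m + a" using y unfolding m times_suc .
  then have "c < a" using plus_mono[of a c "a * m"] c by (meson not_le)
  ultimately show ?thesis by blast
qed

section \<open>Powers of \<omega> and additive principal ordinals\<close>

lemma omega_power_pos: "0 < omega_power x"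
  using omega_power_ge_one[of x] by (simp add: one_ordinal_def osuc_le_iff)

lemma omega_power_strict_mono: "z < x \<Longrightarrow> omega_power z < omega_power x"
proof -
  assume zx: "z < x"
  have "1 < (\<omega> :: 'a ordinal)"
    using osuc_less_Limits[OF omega_in_Limits[where 'a = 'a], of 0] omega_in_Limits[where 'a = 'a]
    by (simp add: Limits_def ordinal_neq_zero_iff one_ordinal_def)
  then have "omega_power z + omega_power z \<le> omega_power z * \<omega>"
    using times_le_iff[of "omega_power z" \<omega> "omega_power z * \<omega>"] by (auto simp: times_one)
  moreover have "omega_power z < omega_power z + omega_power z"
    using plus_strict_mono[OF omega_power_pos, of "omega_power z"] by (simp add: plus_zero)
  ultimately show ?thesis using omega_power_less[OF zx] by simp
qed

lemma le_omega_power: "x \<le> omega_power x"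
proof (induction x rule: less_induct)
  case (less x)
  show ?case
  proof (rule ccontr)
    assume "\<not> x \<le> omega_power x"
    then have "omega_power x < x" by simp
    \<comment> \<open>Strict monotonicity contradicts the induction hypothesis at
      \<open>omega_power x\<close>.\<close>
    then show False using less omega_power_strict_mono leD by blast
  qed
qed

text \<open>Take the least exponent \<open>d\<close> whose power reaches \<open>x\<close>. For
  \<open>z < d\<close> some principal ordinal lies strictly between \<open>omega_power z\<close> and
  \<open>x\<close>, so even \<open>omega_power z * \<omega>\<close> stays below \<open>x\<close>,
  and the power at \<open>d\<close> cannot overshoot.\<close>

lemma limit_points_Class0: "limit_points Class0 \<subseteq> Class0"
proof
  fix x :: "'a ordinal" assume x: "x \<in> limit_points Class0"
  let ?d = "LEAST d. x \<le> omega_power d"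
  have d: "x \<le> omega_power ?d" by (rule LeastI) (rule le_omega_power)
  have above: "\<exists>y>0. z < omega_power y \<and> omega_power y < x" if "z < x" for z
    using x that by (fastforce simp: limit_points_iff Class0_def)
  have "1 < x"
    using above[of 0] x omega_power_strict_mono[of 0] omega_power_zero[where 'a = 'a]
    by (fastforce simp: limit_points_iff ordinal_neq_zero_iff)
  moreover have "omega_power z * \<omega> \<le> x" if "z < ?d" for z
  proof -
    obtain y where "omega_power z < omega_power y" "omega_power y < x"
      using above not_less_Least[OF \<open>z < ?d\<close>] by (meson not_le)
    moreover from this have "z < y" using omega_power_mono by (meson not_le)
    ultimately show ?thesis using omega_power_less by fastforce
  qed
  ultimately have "omega_power ?d \<le> x" by (subst omega_power_le_iff) simp
  then have "x = omega_power ?d" using d by simp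
  moreover from this have "?d \<noteq> 0" using \<open>1 < x\<close> omega_power_zero by (metis order_less_irrefl)
  ultimately show "x \<in> Class0" by (auto simp: Class0_def ordinal_neq_zero_iff)
qed

section \<open>Regular uncountable ordinals\<close>

text \<open>Without a strict bound, \<open>f\<close> would be cofinal in \<open>k\<close> on a
  domain shorter than the cofinality.\<close>

lemma regular_bounded:
  assumes "regular k" "b < k" "\<And>y. y < b \<Longrightarrow> f y < k"
  shows "\<exists>c<k. \<forall>y<b. f y < c"
proof -
  have "b < cofinality k" using assms by (simp add: regular_def)
  then have "\<not> (\<exists>f. f ` {..<b} \<subseteq> {..<k} \<and> (\<forall>x<k. \<exists>y<b. x \<le> f y))"
    unfolding cofinality_def by (rule not_less_Least)
  then show ?thesis using assms(3) by (metis image_subsetI lessThan_iff not_le)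
qed

context
  fixes \<kappa> :: "'a ordinal"
  assumes reg: "regular \<kappa>" and unc: "uncountable {..<\<kappa>}"
begin

lemma regular_in_Limits: "\<kappa> \<in> Limits"
  using reg by (simp add: regular_def)

lemma omega_less_regular: "\<omega> < \<kappa>"
proof -
  have "\<omega> \<le> \<kappa>" unfolding omega_def by (rule Least_le) (rule regular_in_Limits)
  moreover have "\<omega> \<noteq> \<kappa>" using unc countable_lessThan_omega by blast
  ultimately show ?thesis by simp
qed

lemma regular_pos: "0 < \<kappa>"
  using regular_in_Limits by (simp add: Limits_def ordinal_neq_zero_iff)

text \<open>Regularity speaks of families indexed by ordinals, so the sequence is transported along
  the bijection of \<open>nat\<close> with \<omega>.\<close>

lemma regular_bounded_nat:
  fixes f :: "nat \<Rightarrow> 'a ordinal"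
  assumes "\<And>n. f n < \<kappa>"
  shows "\<exists>c<\<kappa>. \<forall>n. f n < c"
proof -
  let ?o = "\<lambda>n. (osuc ^^ n) 0 :: 'a ordinal"
  obtain c where c: "c < \<kappa>" "\<forall>y<\<omega>. f (inv ?o y) < c"
    using regular_bounded[OF reg omega_less_regular, of "\<lambda>y. f (inv ?o y)"] assms by blast
  have "f n < c" for n
  proof -
    have "?o n < \<omega>" using bij_betw_omega by (auto simp: bij_betw_def)
    moreover have "inv ?o (?o n) = n"
      by (rule inv_f_f) (use bij_betw_omega in \<open>auto simp: bij_betw_def\<close>)
    ultimately show ?thesis using c by metis
  qed
  then show ?thesis using c by blast
qed

text \<open>As for products and powers below: the recursion takes a supremum over fewer than
  \<kappa> values that are below \<kappa> by induction, and regularity bounds them.\<close>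

lemma regular_closed_plus: "x < \<kappa> \<Longrightarrow> y < \<kappa> \<Longrightarrow> x + y < \<kappa>"
proof (induction y rule: less_induct)
  case (less y)
  have "\<exists>c<\<kappa>. \<forall>z<y. x + z < c"
    using less by (intro regular_bounded[OF reg]) auto
  then obtain c where c: "c < \<kappa>" "\<forall>z<y. x + z < c" by blast
  then have "x + y \<le> max x c" by (auto simp: plus_le_iff less_max_iff_disj)
  then show ?case using c less.prems by (meson max_less_iff_conj order_le_less_trans)
qed

lemma regular_closed_times: "x < \<kappa> \<Longrightarrow> y < \<kappa> \<Longrightarrow> x * y < \<kappa>"
proof (induction y rule: less_induct)
  case (less y)
  have "\<exists>c<\<kappa>. \<forall>z<y. x * z + x < c"
    using less by (intro regular_bounded[OF reg]) (auto intro: regular_closed_plus)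
  then obtain c where c: "c < \<kappa>" "\<forall>z<y. x * z + x < c" by blast
  then have "x * y \<le> c" by (auto simp: times_le_iff intro: less_imp_le)
  then show ?case using c by simp
qed

lemma regular_closed_omega_power: "x < \<kappa> \<Longrightarrow> omega_power x < \<kappa>"
proof (induction x rule: less_induct)
  case (less x)
  have "\<exists>c<\<kappa>. \<forall>z<x. omega_power z * \<omega> < c"
    using less by (intro regular_bounded[OF reg])
      (auto intro: regular_closed_times omega_less_regular)
  then obtain c where c: "c < \<kappa>" "\<forall>z<x. omega_power z * \<omega> < c" by blast
  then have "omega_power x \<le> max 1 c"
    by (subst omega_power_le_iff) (auto simp: le_max_iff_disj intro: less_imp_le)
  moreover have "1 < \<kappa>"
    using one_le_omega omega_less_regular by (rule order_le_less_trans)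
  ultimately show ?case using c by (meson max_less_iff_conj order_le_less_trans)
qed

text \<open>By closure under powers, \<kappa> is a fixed point of \<open>omega_power\<close>. Hence
  the clauses of \<open>A0\<close> apply with \<kappa> as the principal ordinal.\<close>

lemma regular_in_Class0: "\<kappa> \<in> Class0"
proof -
  have "omega_power \<kappa> \<le> \<kappa>"
  proof (subst omega_power_le_iff, intro conjI allI impI)
    show "1 \<le> \<kappa>" using regular_pos by (simp add: one_ordinal_def osuc_le_iff)
    show "omega_power z * \<omega> \<le> \<kappa>" if "z < \<kappa>" for z
      using that
      by (intro less_imp_le regular_closed_times regular_closed_omega_power omega_less_regular)
  qed
  then have "\<kappa> = omega_power \<kappa>" using le_omega_power by (rule order.antisym[rotated])
  then show ?thesis using regular_pos by (auto simp: Class0_def)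
qed

lemma Class0_unbounded:
  assumes "x < \<kappa>"
  shows "\<exists>y\<in>Class0 \<inter> {..<\<kappa>}. x < y"
proof -
  have "osuc x < \<kappa>" using regular_in_Limits assms by (rule osuc_less_Limits)
  then have "omega_power (osuc x) < \<kappa>" by (rule regular_closed_omega_power)
  moreover have "x < omega_power (osuc x)" using less_osuc le_omega_power by (rule order_less_le_trans)
  moreover have "0 < osuc x" by (simp add: less_osuc_iff)
  ultimately show ?thesis by (auto simp: Class0_def)
qed

text \<open>Closing off: \<open>r\<close> is the supremum of the iterates of a choice function for
  \<open>step\<close>, started at \<open>x\<close>. Any \<open>z < r\<close> is passed by some
  iterate, which together with the next one satisfies \<open>P\<close>. Leaving \<open>P\<close>
  general allows many unbounded sets to be served in one step.\<close>

lemma omega_iteration: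
  assumes step: "\<And>y. y < \<kappa> \<Longrightarrow> \<exists>y'>y. y' < \<kappa> \<and> P y y'" and x: "x < \<kappa>"
  shows "\<exists>r<\<kappa>. x < r \<and> (\<forall>z<r. \<exists>y y'. z < y \<and> y' < r \<and> P y y')"
proof -
  obtain F where F: "\<And>y. y < \<kappa> \<Longrightarrow> y < F y \<and> F y < \<kappa> \<and> P y (F y)" using step by metis
  define f where "f n = (F ^^ n) x" for n
  have f_Suc: "f (Suc n) = F (f n)" for n by (simp add: f_def)
  have fk: "f n < \<kappa>" for n
    by (induction n) (use x F in \<open>auto simp: f_def\<close>)
  have f_less: "f n < f (Suc n)" for n using F[OF fk] by (simp add: f_Suc)
  obtain c where c: "c < \<kappa>" "\<And>n. f n < c" using regular_bounded_nat[of f] fk by blast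
  let ?r = "Sup (range f)"
  have bdd: "bdd_above (range f)" by (rule bdd_above_range_nat)
  have "?r \<le> c" by (rule cSup_least) (auto intro: less_imp_le c)
  then have "?r < \<kappa>" using c(1) by (rule order_le_less_trans)
  moreover have fr: "f n < ?r" for n
    using f_less cSup_upper[OF rangeI bdd, of "Suc n"] by (rule order_less_le_trans)
  moreover have "\<exists>y y'. z < y \<and> y' < ?r \<and> P y y'" if "z < ?r" for z
  proof -
    obtain n where "z < f n" using \<open>z < ?r\<close> less_cSup_iff[OF _ bdd, of z] by auto
    moreover have "P (f n) (f (Suc n))" using F[OF fk] by (simp add: f_Suc)
    ultimately show ?thesis using fr by blast
  qed
  moreover have "x < ?r" using fr[of 0] by (simp add: f_def)
  ultimately show ?thesis by blast
qed

text \<open>Applied in every clause of \<open>A0\<close>. Iterating the passage to a larger element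
  of \<open>B\<close> yields limit points; closedness is
  \<open>limit_points_limit_points\<close>.\<close>

lemma limit_points_closed_unbounded:
  assumes unb: "\<And>x. x < \<kappa> \<Longrightarrow> \<exists>y\<in>B \<inter> {..<\<kappa>}. x < y"
  shows "closed_unbounded_in (limit_points B) \<kappa>"
  unfolding closed_unbounded_in_def
proof (intro conjI allI impI)
  fix x assume x: "x < \<kappa>"
  have "\<exists>r<\<kappa>. x < r \<and> (\<forall>z<r. \<exists>y y'. z < y \<and> y' < r \<and> (y < y' \<and> y' \<in> B))"
    using unb by (intro omega_iteration x) blast
  then obtain r where r: "r < \<kappa>" "x < r" "\<forall>z<r. \<exists>y y'. z < y \<and> y' < r \<and> (y < y' \<and> y' \<in> B)"
    by blast
  have "r \<in> limit_points B"
    unfolding limit_points_iff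
  proof (intro conjI allI impI)
    show "r \<noteq> 0" using r(2) by auto
    show "\<exists>b\<in>B. z < b \<and> b < r" if "z < r" for z
      using r(3) that by (meson order.strict_trans)
  qed
  then show "\<exists>y\<in>limit_points B \<inter> {..<\<kappa>}. x < y" using r by blast
next
  have "limit_points (limit_points B \<inter> {..<\<kappa>}) \<subseteq> limit_points (limit_points B)"
    by (rule limit_points_mono) simp
  then show "limit_points (limit_points B \<inter> {..<\<kappa>}) \<inter> {..<\<kappa>} \<subseteq> limit_points B"
    using limit_points_limit_points by blast
qed

text \<open>Serves the case \<open>t = \<kappa>\<close>, where the class is cut off at
  \<open>\<kappa> + 1\<close>.\<close>

lemma closed_unbounded_in_cong:
  assumes "closed_unbounded_in C \<kappa>" "C \<inter> {..<\<kappa>} = D \<inter> {..<\<kappa>}"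
  shows "closed_unbounded_in D \<kappa>"
proof -
  have "limit_points (D \<inter> {..<\<kappa>}) \<inter> {..<\<kappa>} \<subseteq> C \<inter> {..<\<kappa>}"
    using assms(1) unfolding closed_unbounded_in_def assms(2)[symmetric] by simp
  then show ?thesis
    using assms(1) unfolding closed_unbounded_in_def assms(2) by simp
qed

section \<open>The classes \<open>A0 t\<close>\<close>

lemma T0_bounded:
  assumes "\<kappa> \<le> t"
  shows "\<exists>c<\<kappa>. T0 \<kappa> t \<inter> {..<\<kappa>} \<subseteq> {..<c}"
proof -
  \<comment> \<open>The default 0 keeps all values below \<kappa>, so regularity bounds them over
    all \<open>n < \<omega>\<close>; \<open>t\<close> itself drops out since
    \<open>\<kappa> \<le> t\<close>.\<close>
  let ?f = "\<lambda>n. if left_diff (\<kappa> * n) t < \<kappa> then left_diff (\<kappa> * n) t else 0"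
  have "?f n < \<kappa>" for n using regular_pos by simp
  then obtain c where c: "c < \<kappa>" "\<forall>n<\<omega>. ?f n < c"
    using regular_bounded[OF reg omega_less_regular, of ?f] by blast
  have "T0 \<kappa> t \<inter> {..<\<kappa>} \<subseteq> {..<c}" using c(2) assms by (auto simp: T0_def)
  then show ?thesis using c(1) by blast
qed

text \<open>The remainder of \<open>s\<close> modulo \<kappa> is the left difference recorded in
  \<open>T0\<close>. So a bound on \<open>T0 \<kappa> s\<close> below \<kappa> confines
  \<open>s\<close> to a family indexed by a quotient below \<omega> and a bounded remainder.\<close>

lemma T0_decomposition:
  assumes "s \<in> {\<kappa>..<\<kappa> * \<omega>}"
  shows "\<exists>m c. m < \<omega> \<and> c \<in> T0 \<kappa> s \<inter> {..<\<kappa>} \<and> s = \<kappa> * m + c"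
proof -
  obtain m c where mc: "m < \<omega>" "c < \<kappa>" "s = \<kappa> * m + c"
    using assms ordinal_division[of s \<kappa>] by auto
  have "m \<noteq> 0"
  proof
    assume "m = 0"
    then show False using assms mc by (auto simp: times_zero zero_plus)
  qed
  then have "1 \<le> m" by (simp add: ordinal_neq_zero_iff one_ordinal_def osuc_le_iff)
  moreover have "\<kappa> * m \<le> s" using plus_mono[of 0 c "\<kappa> * m"] mc by (simp add: plus_zero)
  moreover have "s < \<kappa> * m + \<kappa>" using mc by (simp add: plus_strict_mono)
  moreover have "left_diff (\<kappa> * m) s = c" using mc by (simp add: left_diff_plus)
  ultimately have "c \<in> T0 \<kappa> s"
    using assms mc(1) by (auto simp: T0_def)
  then show ?thesis using mc by blast
qed

text \<open>Regularity is applied twice to chosen witnesses: over the remainders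
  \<open>c < y\<close> for each fixed \<open>m\<close>, then over the quotients
  \<open>m < \<omega>\<close>.\<close>

lemma common_bound:
  assumes unb: "\<And>s y. s \<in> S \<Longrightarrow> y < \<kappa> \<Longrightarrow> \<exists>b\<in>A s \<inter> {..<\<kappa>}. y < b"
    and y: "y < \<kappa>"
  shows "\<exists>e<\<kappa>. \<forall>m<\<omega>. \<forall>c<y. \<kappa> * m + c \<in> S \<longrightarrow> (\<exists>b\<in>A (\<kappa> * m + c). y < b \<and> b < e)"
proof -
  define g where "g s = (if s \<in> S then SOME b. b \<in> A s \<and> b < \<kappa> \<and> y < b else 0)" for s
  have g: "g s \<in> A s \<and> g s < \<kappa> \<and> y < g s" if "s \<in> S" for s
  proof -
    have "\<exists>b. b \<in> A s \<and> b < \<kappa> \<and> y < b" using unb[OF that y] by blast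
    from someI_ex[OF this] show ?thesis using that by (simp add: g_def)
  qed
  have gk: "g s < \<kappa>" for s using g[of s] regular_pos by (cases "s \<in> S") (auto simp: g_def)
  have "\<exists>e<\<kappa>. \<forall>c<y. g (\<kappa> * m + c) < e" for m
    by (rule regular_bounded[OF reg y]) (rule gk)
  then obtain h where h: "\<And>m. h m < \<kappa>" "\<And>m c. c < y \<Longrightarrow> g (\<kappa> * m + c) < h m" by metis
  obtain e where e: "e < \<kappa>" "\<And>m. m < \<omega> \<Longrightarrow> h m < e"
    using regular_bounded[OF reg omega_less_regular, of h] h(1) by blast
  have "\<exists>b\<in>A (\<kappa> * m + c). y < b \<and> b < e" if "m < \<omega>" "c < y" "\<kappa> * m + c \<in> S" for m c
    using g[OF that(3)] h(2)[OF that(2)] e(2)[OF that(1)] order.strict_trans by blast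
  then show ?thesis using e(1) by blast
qed

text \<open>The family \<open>A\<close> stands for the classes known from the induction. Closing off
  makes \<open>r\<close> a limit point of \<open>Class0\<close> and of every relevant
  \<open>A s\<close>; closedness then puts \<open>r\<close> into them.\<close>

lemma A0_limit_base_unbounded:
  assumes t: "t \<in> {\<kappa><..<\<kappa> * \<omega>}"
    and club: "\<And>s. s \<in> {\<kappa><..<t} \<Longrightarrow> closed_unbounded_in (A s) \<kappa>"
    and x: "x < \<kappa>"
  shows "\<exists>r\<in>{r \<in> Class0 \<inter> {..<\<kappa> + 1}. T0 \<kappa> t \<inter> {..<\<kappa>} \<subseteq> {..<r} \<and>
    (\<forall>s\<in>{\<kappa><..<t}. T0 \<kappa> s \<inter> {..<\<kappa>} \<subseteq> {..<r} \<longrightarrow> r \<in> A s)} \<inter> {..<\<kappa>}. x < r"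
proof -
  obtain d where d: "d < \<kappa>" "T0 \<kappa> t \<inter> {..<\<kappa>} \<subseteq> {..<d}" using T0_bounded[of t] t by (meson greaterThanLessThan_iff less_imp_le)
  define P where "P y y' \<longleftrightarrow> (\<exists>p\<in>Class0. y < p \<and> p < y') \<and>
    (\<forall>m<\<omega>. \<forall>c<y. \<kappa> * m + c \<in> {\<kappa><..<t} \<longrightarrow> (\<exists>b\<in>A (\<kappa> * m + c). y < b \<and> b < y'))" for y y'
  have step: "\<exists>y'>y. y' < \<kappa> \<and> P y y'" if y: "y < \<kappa>" for y
  proof -
    obtain p where p: "p \<in> Class0" "p < \<kappa>" "y < p" using Class0_unbounded[OF y] by auto
    obtain e where e: "e < \<kappa>" "\<forall>m<\<omega>. \<forall>c<y. \<kappa> * m + c \<in> {\<kappa><..<t} \<longrightarrow>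
        (\<exists>b\<in>A (\<kappa> * m + c). y < b \<and> b < e)"
      using common_bound[of "{\<kappa><..<t}" A y] club y unfolding closed_unbounded_in_def by blast
    \<comment> \<open>\<open>osuc p\<close> because \<open>P\<close> wants the principal ordinal
      strictly below the new stage.\<close>
    have "P y (max (osuc p) e)"
      using p e unfolding P_def by (meson less_max_iff_disj less_osuc)
    moreover have "y < max (osuc p) e" using p by (meson less_max_iff_disj less_osuc order.strict_trans)
    moreover have "max (osuc p) e < \<kappa>"
      using p e osuc_less_Limits[OF regular_in_Limits] by simp
    ultimately show ?thesis by blast
  qed
  \<comment> \<open>Starting above \<open>d\<close> secures the condition on
    \<open>T0 \<kappa> t\<close>.\<close>
  have "max x d < \<kappa>" using x d by simp
  from omega_iteration[of P, OF step this]
  obtain r where r: "r < \<kappa>" "max x d < r" "\<forall>z<r. \<exists>y y'. z < y \<and> y' < r \<and> P y y'"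
    by blast
  then have r0: "r \<noteq> 0" by auto
  have "r \<in> limit_points Class0"
    unfolding limit_points_iff using r0 r(3) unfolding P_def by (meson order.strict_trans)
  then have "r \<in> Class0" using limit_points_Class0 by blast
  moreover have "T0 \<kappa> t \<inter> {..<\<kappa>} \<subseteq> {..<r}" using d r(2) by auto
  moreover have "r \<in> A s" if s: "s \<in> {\<kappa><..<t}" "T0 \<kappa> s \<inter> {..<\<kappa>} \<subseteq> {..<r}" for s
  proof -
    have "s \<in> {\<kappa>..<\<kappa> * \<omega>}" using s t by auto
    then obtain m c where mc: "m < \<omega>" "c < r" "s = \<kappa> * m + c"
      using T0_decomposition s(2) by blast
    have "\<exists>b\<in>A s \<inter> {..<\<kappa>}. z < b \<and> b < r" if "z < r" for z
    proof -
      \<comment> \<open>The stage must pass \<open>c\<close> as well as \<open>z\<close>, since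
        \<open>P y y'\<close> only treats remainders below \<open>y\<close>.\<close>
      obtain y y' where y: "max z c < y" "y' < r" "P y y'"
        using r(3) \<open>z < r\<close> mc(2) by (metis max_less_iff_conj)
      then obtain b where b: "b \<in> A s" "y < b" "b < y'"
        using mc s(1) unfolding P_def by auto
      then show ?thesis using y r(1) by (intro bexI[of _ b]) auto
    qed
    then have "r \<in> limit_points (A s \<inter> {..<\<kappa>})" using r0 by (simp add: limit_points_iff)
    then show ?thesis using club[OF s(1)] r(1) unfolding closed_unbounded_in_def by blast
  qed
  ultimately show ?thesis using r(1,2) by (auto simp: plus_one less_osuc_iff)
qed

lemma A0_closed_unbounded:
  "t \<in> {\<kappa>..<\<kappa> * \<omega>} \<Longrightarrow> closed_unbounded_in (A0 t) \<kappa>"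
proof (induction t rule: less_induct)
  case (less t)
  consider "t = \<kappa>" | "t \<in> {\<kappa><..<\<kappa> * \<omega>}" "t \<in> Limits" | "t \<in> {\<kappa><..<\<kappa> * \<omega>}" "t \<notin> Limits"
    using less.prems by force
  then show ?case
  proof cases
    case 1
    have "closed_unbounded_in (limit_points Class0) \<kappa>"
      using Class0_unbounded by (rule limit_points_closed_unbounded)
    then show ?thesis
      unfolding 1 A0_principal[OF regular_in_Class0]
      by (rule closed_unbounded_in_cong) (auto simp: plus_one less_osuc_iff)
  next
    case 2
    show ?thesis
      unfolding A0_limit[OF regular_in_Class0 2]
      by (intro limit_points_closed_unbounded A0_limit_base_unbounded 2 less.IH)
        (use 2 in auto)
  next
    case 3
    then have "t \<noteq> 0" by auto
    then obtain l where l: "t = l + 1" using 3 by (auto simp: Limits_def)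
    \<comment> \<open>\<open>l = \<kappa>\<close> is possible, which is why the induction includes
      the left endpoint.\<close>
    have "l < t" "\<kappa> \<le> l" using 3 by (simp_all add: l plus_one less_osuc_iff)
    then have "closed_unbounded_in (A0 l) \<kappa>" using less 3 by auto
    then show ?thesis
      unfolding l A0_suc[OF regular_in_Class0 3(1)[unfolded l]]
      by (intro limit_points_closed_unbounded) (simp add: closed_unbounded_in_def)
  qed
qed

end

theorem proposition15:
  fixes \<kappa> t :: "'a ordinal"
  assumes "regular \<kappa>" and "uncountable {..<\<kappa>}"
    and "t \<in> {\<kappa>..<\<kappa> * \<omega>}"
  shows "closed_unbounded_in (A0 t) \<kappa>"
  using assms by (rule A0_closed_unbounded)

end
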